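(* For every graph $\mathcal{G}$ there is, up to isomorphism, a unique minimal symplectic root system over $\mathbb{F}_2$ on $\mathcal{G}$, and all symplectic root systems over $\mathbb{F}_2$ on $\mathcal{G}$ are quotients of it.
   Context: Graphs are finite, undirected, without loops or multiple edges; vector spaces are finite-dimensional. A symplectic vector space over a field $\Bbbk$ is a $\Bbbk$-vector space $V$ with a (possibly degenerate) bilinear form $\langle,\rangle:V\times V\to\Bbbk$ such that $\langle v,v\rangle=0$ for all $v\in V$. A symplectic homomorphism $\phi:V\to W$ is a linear map with $\langle v,w\rangle_V=\langle\phi(v),\phi(w)\rangle_W$ for all $v,w\in V$. A symplectic root system $F=(f,V)$ over $\mathbb{F}_2$ on a graph $\mathcal{G}$ consists of a symplectic vector space $V$ over $\mathbb{F}_2$ and a map $f$ from the nodes of $\mathcal{G}$ to $V$ such that the image $f(\mathcal{G})$ generates $V$, and two nodes $\alpha,\beta$ are adjacent in $\mathcal{G}$ if and only if $\langle f(\alpha),f(\beta)\rangle\neq 0$. It is minimal if the family $\{f(\alpha)\}_{\alpha\in\mathcal{G}}$ is a basis of $V$. An isomorphism of symplectic root systems $(f,V)\to(g,W)$ on the same graph is a bijective linear map $\phi:V\to W$ with $\phi\circ f=g$. A quotient of a symplectic root system $(f,V)$ on $\mathcal{G}$ is a symplectic root system on $\mathcal{G}$ of the form $(\phi\circ f,W)$, where $\phi:V\to W$ is a surjective symplectic homomorphism. *)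

theory Defs
  imports
    "HOL-Library.Z2"
    "Jordan_Normal_Form.VS_Connect"
    "Graph_Theory.Digraph"
begin

text \<open>
  Vector spaces are the carrier-based ones of the locale \<^locale>\<open>vectorspace\<close>, so the underlying set of
  a space may be any set. Graphs are those of the locale \<^locale>\<open>graph\<close>: finite symmetric digraphs
  without loops or parallel arcs, an undirected edge being a pair of opposite arcs.
\<close>

abbreviation F2 :: "bit ring" where
  "F2 \<equiv> class_ring"

text \<open>The form may be degenerate; its values outside the carrier are irrelevant.\<close>

locale symplectic_space = vectorspace K V
  for K :: "('k, 'm) ring_scheme" and V :: "('k, 'v, 'n) module_scheme" +
  fixes form :: "'v \<Rightarrow> 'v \<Rightarrow> 'k"
  assumes finite_dimensional: fin_dim
    and form_closed:
      "\<lbrakk>u \<in> carrier V; v \<in> carrier V\<rbrakk> \<Longrightarrow> form u v \<in> carrier K"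
    and form_add_left:
      "\<lbrakk>u \<in> carrier V; v \<in> carrier V; w \<in> carrier V\<rbrakk>
        \<Longrightarrow> form (u \<oplus>\<^bsub>V\<^esub> v) w = form u w \<oplus>\<^bsub>K\<^esub> form v w"
    and form_add_right:
      "\<lbrakk>u \<in> carrier V; v \<in> carrier V; w \<in> carrier V\<rbrakk>
        \<Longrightarrow> form u (v \<oplus>\<^bsub>V\<^esub> w) = form u v \<oplus>\<^bsub>K\<^esub> form u w"
    and form_smult_left:
      "\<lbrakk>a \<in> carrier K; u \<in> carrier V; v \<in> carrier V\<rbrakk>
        \<Longrightarrow> form (a \<odot>\<^bsub>V\<^esub> u) v = a \<otimes>\<^bsub>K\<^esub> form u v"
    and form_smult_right:
      "\<lbrakk>a \<in> carrier K; u \<in> carrier V; v \<in> carrier V\<rbrakk>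
        \<Longrightarrow> form u (a \<odot>\<^bsub>V\<^esub> v) = a \<otimes>\<^bsub>K\<^esub> form u v"
    and form_alternating: "v \<in> carrier V \<Longrightarrow> form v v = \<zero>\<^bsub>K\<^esub>"

locale symplectic_hom =
  dom: symplectic_space K V B + cod: symplectic_space K W C + linear_map K V W \<phi>
  for K and V and B and W and C and \<phi> +
  assumes preserves_form:
    "\<lbrakk>u \<in> carrier V; v \<in> carrier V\<rbrakk> \<Longrightarrow> B u v = C (\<phi> u) (\<phi> v)"

text \<open>
  A symplectic root system \<open>(f, V)\<close> on \<open>G\<close> over the two-element field. The map \<open>f\<close> is only
  considered on the nodes of \<open>G\<close>.
\<close>

locale symplectic_root_system =
  graph G + symplectic_space F2 V form
  for G :: "('a, 'b) pre_digraph" and V :: "(bit, 'v) module" and form +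
  fixes f :: "'a \<Rightarrow> 'v"
  assumes root_closed: "\<alpha> \<in> verts G \<Longrightarrow> f \<alpha> \<in> carrier V"
    and roots_generate: "gen_set (f ` verts G)"
    and adjacent_iff:
      "\<lbrakk>\<alpha> \<in> verts G; \<beta> \<in> verts G\<rbrakk> \<Longrightarrow> \<alpha> \<rightarrow>\<^bsub>G\<^esub> \<beta> \<longleftrightarrow> form (f \<alpha>) (f \<beta>) \<noteq> 0"

text \<open>
  The family of roots is a basis; injectivity is needed because \<^const>\<open>vectorspace.basis\<close> is a
  property of sets, which ignores repetitions.
\<close>

locale minimal_symplectic_root_system = symplectic_root_system +
  assumes roots_inj: "inj_on f (verts G)"
    and roots_basis: "basis (f ` verts G)"

definition srs_isomorphic ::
  "('a, 'b) pre_digraph \<Rightarrow> (bit, 'v) module \<Rightarrow> ('a \<Rightarrow> 'v) \<Rightarrow> (bit, 'w) module \<Rightarrow> ('a \<Rightarrow> 'w) \<Rightarrow> bool"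
  where "srs_isomorphic G V f W g \<longleftrightarrow>
    (\<exists>\<phi>. linear_map F2 V W \<phi> \<and> bij_betw \<phi> (carrier V) (carrier W) \<and>
      (\<forall>\<alpha>\<in>verts G. \<phi> (f \<alpha>) = g \<alpha>))"

text \<open>\<open>(g, W)\<close> is a quotient of \<open>(f, V)\<close>.\<close>

definition srs_quotient_of ::
  "('a, 'b) pre_digraph \<Rightarrow> (bit, 'w) module \<Rightarrow> ('w \<Rightarrow> 'w \<Rightarrow> bit) \<Rightarrow> ('a \<Rightarrow> 'w) \<Rightarrow>
    (bit, 'v) module \<Rightarrow> ('v \<Rightarrow> 'v \<Rightarrow> bit) \<Rightarrow> ('a \<Rightarrow> 'v) \<Rightarrow> bool"
  where "srs_quotient_of G W C g V B f \<longleftrightarrow>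
    symplectic_root_system G V B f \<and> symplectic_root_system G W C g \<and>
    (\<exists>\<phi>. symplectic_hom F2 V B W C \<phi> \<and> \<phi> ` carrier V = carrier W \<and>
      (\<forall>\<alpha>\<in>verts G. g \<alpha> = \<phi> (f \<alpha>)))"

end

theory Submission
  imports Defs
begin

text \<open>
  A linear map can be prescribed arbitrarily, and uniquely, on a basis. Applied
  to the roots of a minimal system this produces a map to any other system; its image contains the
  roots, hence everything, and it preserves the forms because it does so on roots, where over
  the two-element field adjacency leaves only one possible value. Between two minimal systems
  the maps in both directions are mutually inverse, because they are so on the roots. A minimal
  system exists on the space of functions on the nodes, with the adjacency matrix as Gram matrix;
  this form is alternating because the matrix is symmetric with zero diagonal and the characteristic is 2.
\<close>

section \<open>Linear maps prescribed on generators and bases\<close>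

text \<open>The vectors satisfying \<open>P\<close> form a submodule, the last three cases being its
  closure conditions. A submodule that contains \<open>S\<close> contains the span of
  \<open>S\<close>, which is the whole space.\<close>

lemma (in vectorspace) gen_set_induct [consumes 3, case_names base zero add smult]:
  assumes gen: "gen_set S" and S: "S \<subseteq> carrier V" and v: "v \<in> carrier V"
    and base: "\<And>s. s \<in> S \<Longrightarrow> P s"
    and zero: "P \<zero>\<^bsub>V\<^esub>"
    and add: "\<And>u w. \<lbrakk>u \<in> carrier V; w \<in> carrier V; P u; P w\<rbrakk> \<Longrightarrow> P (u \<oplus>\<^bsub>V\<^esub> w)"
    and smult: "\<And>a u. \<lbrakk>a \<in> carrier K; u \<in> carrier V; P u\<rbrakk> \<Longrightarrow> P (a \<odot>\<^bsub>V\<^esub> u)"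
  shows "P v"
proof -
  have "submodule K {u \<in> carrier V. P u} V"
    by (rule submodule.intro) (auto intro: zero add smult module_axioms)
  then have "span S \<subseteq> {u \<in> carrier V. P u}"
    using S base by (intro span_is_subset) auto
  then show ?thesis using gen v by auto
qed

text \<open>Uniqueness of coordinates makes each coordinate function linear. The map sends a vector
  to the combination of the values of \<open>h\<close> with the same coordinates, so it is linear
  too.\<close>

lemma (in vectorspace) linear_extension:
  assumes fin: "finite A" and A: "basis A" and W: "vectorspace K W"
    and h: "h \<in> A \<rightarrow> carrier W"
  obtains \<phi> where "linear_map K V W \<phi>" and "\<And>v. v \<in> A \<Longrightarrow> \<phi> v = h v"
proof -
  interpret W: vectorspace K W by (rule W)
  have AV: "A \<subseteq> carrier V" using A by (auto simp: basis_def)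
  \<comment> \<open>Coordinate families are extensional functions on \<open>A\<close>: their values
    off \<open>A\<close> are fixed, so the uniqueness supplied by \<open>basis_criterion\<close> is
    equality of functions and the description is well defined.\<close>
  define coord where
    "coord v = (THE a. a \<in> A \<rightarrow>\<^sub>E carrier K \<and> lincomb a A = v)" for v
  have ex1: "\<exists>!a. a \<in> A \<rightarrow>\<^sub>E carrier K \<and> lincomb a A = v" if "v \<in> carrier V" for v
    using basis_criterion[OF fin AV] A that by blast
  have coord: "coord v \<in> A \<rightarrow>\<^sub>E carrier K" "lincomb (coord v) A = v" if "v \<in> carrier V" for v
    using theI'[OF ex1[OF that]] by (auto simp: coord_def)
  \<comment> \<open>Any coefficients in the field can be read back from their combination. Linearity
    of \<open>coord\<close> follows by exhibiting the pointwise sum or multiple as such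
    coefficients.\<close>
  have coord_eq: "coord (lincomb a A) x = a x" if "a \<in> A \<rightarrow> carrier K" "x \<in> A" for a x
  proof -
    have "restrict a A \<in> A \<rightarrow>\<^sub>E carrier K" using that by auto
    moreover have "lincomb (restrict a A) A = lincomb a A"
      using that AV by (intro lincomb_cong) auto
    moreover have "lincomb a A \<in> carrier V" using that AV by auto
    ultimately have "coord (lincomb a A) = restrict a A"
      unfolding coord_def by (intro the1_equality ex1) auto
    then show ?thesis using that by simp
  qed
  have coordK: "coord v x \<in> carrier K" if "v \<in> carrier V" "x \<in> A" for v x
    using coord(1)[OF that(1)] that(2) by auto
  have coord_add: "coord (u \<oplus>\<^bsub>V\<^esub> v) x = coord u x \<oplus>\<^bsub>K\<^esub> coord v x"
    if "u \<in> carrier V" "v \<in> carrier V" "x \<in> A" for u v x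
  proof -
    have "lincomb (\<lambda>x. coord u x \<oplus>\<^bsub>K\<^esub> coord v x) A = u \<oplus>\<^bsub>V\<^esub> v"
      using that coord coordK fin AV by (subst lincomb_sum) auto
    then show ?thesis using coord_eq[of "\<lambda>x. coord u x \<oplus>\<^bsub>K\<^esub> coord v x" x] that coordK by auto
  qed
  have coord_smult: "coord (c \<odot>\<^bsub>V\<^esub> v) x = c \<otimes>\<^bsub>K\<^esub> coord v x"
    if "c \<in> carrier K" "v \<in> carrier V" "x \<in> A" for c v x
  proof -
    have "lincomb (\<lambda>x. c \<otimes>\<^bsub>K\<^esub> coord v x) A = c \<odot>\<^bsub>V\<^esub> v"
      using that coord coordK fin AV by (subst lincomb_smult) auto
    then show ?thesis using coord_eq[of "\<lambda>x. c \<otimes>\<^bsub>K\<^esub> coord v x" x] that coordK by auto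
  qed
  define \<phi> where "\<phi> v = (\<Oplus>\<^bsub>W\<^esub>x\<in>A. coord v x \<odot>\<^bsub>W\<^esub> h x)" for v
  have hW: "h x \<in> carrier W" if "x \<in> A" for x using h that by auto
  have "\<phi> \<in> LinearCombinations.module_hom K V W"
    unfolding LinearCombinations.module_hom_def
  proof (intro CollectI conjI allI impI)
    show "\<phi> \<in> carrier V \<rightarrow> carrier W"
      unfolding \<phi>_def using coordK hW by (auto intro!: W.finsum_closed)
  next
    fix u v assume uv: "u \<in> carrier V \<and> v \<in> carrier V"
    have "\<phi> (u \<oplus>\<^bsub>V\<^esub> v) = (\<Oplus>\<^bsub>W\<^esub>x\<in>A. coord u x \<odot>\<^bsub>W\<^esub> h x \<oplus>\<^bsub>W\<^esub> coord v x \<odot>\<^bsub>W\<^esub> h x)"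
      unfolding \<phi>_def
      by (intro W.finsum_cong') (use uv coordK hW in \<open>auto simp: coord_add W.smult_l_distr\<close>)
    also have "\<dots> = \<phi> u \<oplus>\<^bsub>W\<^esub> \<phi> v"
      unfolding \<phi>_def using uv coordK hW by (intro W.finsum_addf) auto
    finally show "\<phi> (u \<oplus>\<^bsub>V\<^esub> v) = \<phi> u \<oplus>\<^bsub>W\<^esub> \<phi> v" .
  next
    fix c v assume cv: "c \<in> carrier K \<and> v \<in> carrier V"
    have "\<phi> (c \<odot>\<^bsub>V\<^esub> v) = (\<Oplus>\<^bsub>W\<^esub>x\<in>A. c \<odot>\<^bsub>W\<^esub> (coord v x \<odot>\<^bsub>W\<^esub> h x))"
      unfolding \<phi>_def
      by (intro W.finsum_cong') (use cv coordK hW in \<open>auto simp: coord_smult W.smult_assoc1\<close>)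
    also have "\<dots> = c \<odot>\<^bsub>W\<^esub> \<phi> v"
      unfolding \<phi>_def using cv coordK hW by (intro W.finsum_smult[symmetric]) auto
    finally show "\<phi> (c \<odot>\<^bsub>V\<^esub> v) = c \<odot>\<^bsub>W\<^esub> \<phi> v" .
  qed
  then have "linear_map K V W \<phi>"
    by (intro linear_map.intro mod_hom.intro mod_hom_axioms.intro
        vectorspace_axioms W.vectorspace_axioms module_axioms W.module_axioms)
  moreover have "\<phi> v = h v" if v: "v \<in> A" for v
  proof -
    \<comment> \<open>The coordinates of a basis vector \<open>v\<close> are the indicator of
      \<open>v\<close>, which leaves a single term in the sum defining \<phi>.\<close>
    define e where "e x = (if v = x then \<one>\<^bsub>K\<^esub> else \<zero>\<^bsub>K\<^esub>)" for x
    have e: "e \<in> A \<rightarrow> carrier K" by (auto simp: e_def)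
    have "lincomb e A = (\<Oplus>\<^bsub>V\<^esub>x\<in>A. if v = x then x else \<zero>\<^bsub>V\<^esub>)"
      unfolding lincomb_def using AV by (intro M.finsum_cong') (auto simp: e_def)
    also have "\<dots> = v" using v fin AV by (subst M.finsum_singleton) auto
    finally have "coord v x = e x" if "x \<in> A" for x
      using coord_eq[OF e that] by simp
    then have "\<phi> v = (\<Oplus>\<^bsub>W\<^esub>x\<in>A. if v = x then h x else \<zero>\<^bsub>W\<^esub>)"
      unfolding \<phi>_def using hW by (intro W.finsum_cong') (auto simp: e_def)
    also have "\<dots> = h v" using v fin hW by (subst W.finsum_singleton) auto
    finally show ?thesis .
  qed
  ultimately show thesis by (rule that)
qed

text \<open>Agreement of two linear maps survives sums and multiples, so it spreads from
  \<open>X\<close> to its span.\<close>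

lemma linear_map_eq_on_gen_set:
  assumes T: "linear_map K V W T" and S: "linear_map K V W S"
    and X: "module.gen_set K V X" "X \<subseteq> carrier V"
    and eq: "\<And>x. x \<in> X \<Longrightarrow> T x = S x" and v: "v \<in> carrier V"
  shows "T v = S v"
proof -
  interpret T: linear_map K V W T by (rule T)
  interpret S: linear_map K V W S by (rule S)
  show ?thesis using X v
    by (induction rule: T.V.gen_set_induct) (auto simp: eq)
qed

lemma linear_map_comp:
  assumes "linear_map K U V S" and "linear_map K V W T"
  shows "linear_map K U W (T \<circ> S)"
proof -
  interpret S: linear_map K U V S by (rule assms)
  interpret T: linear_map K V W T by (rule assms)
  show ?thesis by unfold_locales (auto simp: LinearCombinations.module_hom_def)
qed

lemma linear_map_id:
  assumes "vectorspace K V"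
  shows "linear_map K V V id"
proof -
  interpret vectorspace K V by (rule assms)
  show ?thesis by unfold_locales (auto simp: LinearCombinations.module_hom_def)
qed

section \<open>Maps out of a minimal system and its uniqueness\<close>

text \<open>Values have to be prescribed on vectors, whereas roots are indexed by nodes. Injectivity
  of \<open>f\<close> on the nodes bridges this: a root is sent to the value of \<open>g\<close> at
  the one node it comes from.\<close>

lemma (in minimal_symplectic_root_system) extend_roots:
  assumes "symplectic_root_system G W C g"
  obtains \<phi> where "linear_map F2 V W \<phi>" and "\<And>\<alpha>. \<alpha> \<in> verts G \<Longrightarrow> \<phi> (f \<alpha>) = g \<alpha>"
proof -
  interpret W: symplectic_root_system G W C g by (rule assms)
  obtain \<phi> where \<phi>: "linear_map F2 V W \<phi>"
    "\<And>v. v \<in> f ` verts G \<Longrightarrow> \<phi> v = g (inv_into (verts G) f v)"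
  proof (rule linear_extension[of "f ` verts G" W "\<lambda>v. g (inv_into (verts G) f v)"])
    show "(\<lambda>v. g (inv_into (verts G) f v)) \<in> f ` verts G \<rightarrow> carrier W"
      by (auto intro: W.root_closed inv_into_into)
  qed (use roots_basis W.vectorspace_axioms in auto)
  then show thesis using that[of \<phi>] roots_inj by simp
qed

lemma minimal_imp_isomorphic:
  assumes "minimal_symplectic_root_system G V B f" and "minimal_symplectic_root_system G W C g"
  shows "srs_isomorphic G V f W g"
proof -
  interpret V: minimal_symplectic_root_system G V B f by (rule assms)
  interpret W: minimal_symplectic_root_system G W C g by (rule assms)
  obtain \<phi> where \<phi>: "linear_map F2 V W \<phi>" "\<And>\<alpha>. \<alpha> \<in> verts G \<Longrightarrow> \<phi> (f \<alpha>) = g \<alpha>"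
    using V.extend_roots[OF W.symplectic_root_system_axioms] by blast
  obtain \<psi> where \<psi>: "linear_map F2 W V \<psi>" "\<And>\<alpha>. \<alpha> \<in> verts G \<Longrightarrow> \<psi> (g \<alpha>) = f \<alpha>"
    using W.extend_roots[OF V.symplectic_root_system_axioms] by blast
  \<comment> \<open>Both sides are linear and agree on the generating roots, because \<phi> takes
    \<open>f \<alpha>\<close> to \<open>g \<alpha>\<close> and \<psi> takes it back.\<close>
  have 1: "(\<psi> \<circ> \<phi>) v = id v" if "v \<in> carrier V" for v
    by (rule linear_map_eq_on_gen_set[OF linear_map_comp[OF \<phi>(1) \<psi>(1)]
          linear_map_id[OF V.vectorspace_axioms] V.roots_generate _ _ that])
      (auto simp: \<phi>(2) \<psi>(2) V.root_closed)
  have 2: "(\<phi> \<circ> \<psi>) w = id w" if "w \<in> carrier W" for w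
    by (rule linear_map_eq_on_gen_set[OF linear_map_comp[OF \<psi>(1) \<phi>(1)]
          linear_map_id[OF W.vectorspace_axioms] W.roots_generate _ _ that])
      (auto simp: \<phi>(2) \<psi>(2) W.root_closed)
  have "bij_betw \<phi> (carrier V) (carrier W)"
  proof (rule bij_betw_byWitness[where f' = \<psi>])
    interpret \<phi>: linear_map F2 V W \<phi> by (rule \<phi>(1))
    interpret \<psi>: linear_map F2 W V \<psi> by (rule \<psi>(1))
    show "\<phi> ` carrier V \<subseteq> carrier W" "\<psi> ` carrier W \<subseteq> carrier V" by auto
  qed (use 1 2 in auto)
  then show ?thesis using \<phi> by (auto simp: srs_isomorphic_def)
qed

section \<open>Preservation of forms and quotients\<close>

context symplectic_space
begin

lemma form_zero_left: "v \<in> carrier V \<Longrightarrow> form \<zero>\<^bsub>V\<^esub> v = \<zero>\<^bsub>K\<^esub>"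
  using form_smult_left[of "\<zero>\<^bsub>K\<^esub>" v v] by (simp add: form_closed)

lemma form_zero_right: "v \<in> carrier V \<Longrightarrow> form v \<zero>\<^bsub>V\<^esub> = \<zero>\<^bsub>K\<^esub>"
  using form_smult_right[of "\<zero>\<^bsub>K\<^esub>" v v] by (simp add: form_closed)

end

text \<open>Bilinearity is used one argument at a time. The first induction frees the left argument
  while the right one stays in \<open>X\<close>; its result is the base case of the second, which
  frees the right argument.\<close>

lemma symplectic_homI_gen_set:
  assumes V: "symplectic_space K V B" and W: "symplectic_space K W C"
    and \<phi>: "linear_map K V W \<phi>"
    and X: "module.gen_set K V X" "X \<subseteq> carrier V"
    and eq: "\<And>x y. \<lbrakk>x \<in> X; y \<in> X\<rbrakk> \<Longrightarrow> B x y = C (\<phi> x) (\<phi> y)"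
  shows "symplectic_hom K V B W C \<phi>"
proof -
  interpret V: symplectic_space K V B by (rule V)
  interpret W: symplectic_space K W C by (rule W)
  interpret \<phi>: linear_map K V W \<phi> by (rule \<phi>)
  have left: "B u y = C (\<phi> u) (\<phi> y)" if "u \<in> carrier V" "y \<in> X" for u y
    using X that(1)
  proof (induction rule: V.gen_set_induct)
    case (base s)
    then show ?case using eq that by simp
  qed (use that(2) X(2) in \<open>auto simp: subsetD V.form_zero_left W.form_zero_left
      V.form_add_left W.form_add_left V.form_smult_left W.form_smult_left\<close>)
  have "B u v = C (\<phi> u) (\<phi> v)" if "u \<in> carrier V" "v \<in> carrier V" for u v
    using X that(2)
  proof (induction rule: V.gen_set_induct)
    case (base s)
    then show ?case using left that by simp
  qed (use that(1) in \<open>auto simp: V.form_zero_right W.form_zero_right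
      V.form_add_right W.form_add_right V.form_smult_right W.form_smult_right\<close>)
  then show ?thesis by unfold_locales
qed

lemma quotient_of_minimal:
  assumes "minimal_symplectic_root_system G V B f" and "symplectic_root_system G W C g"
  shows "srs_quotient_of G W C g V B f"
proof -
  interpret V: minimal_symplectic_root_system G V B f by (rule assms)
  interpret W: symplectic_root_system G W C g by (rule assms)
  obtain \<phi> where \<phi>: "linear_map F2 V W \<phi>" "\<And>\<alpha>. \<alpha> \<in> verts G \<Longrightarrow> \<phi> (f \<alpha>) = g \<alpha>"
    using V.extend_roots[OF W.symplectic_root_system_axioms] by blast
  interpret \<phi>: linear_map F2 V W \<phi> by (rule \<phi>(1))
  \<comment> \<open>Both values are nonzero exactly when the nodes are adjacent, and 1 is the only
    nonzero element of \<open>bit\<close>. Over a larger field adjacency would not determine the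
    value.\<close>
  have roots: "B (f \<alpha>) (f \<beta>) = C (g \<alpha>) (g \<beta>)" if "\<alpha> \<in> verts G" "\<beta> \<in> verts G" for \<alpha> \<beta>
    using V.adjacent_iff[OF that] W.adjacent_iff[OF that]
    by (cases "B (f \<alpha>) (f \<beta>)"; cases "C (g \<alpha>) (g \<beta>)") auto
  have "symplectic_hom F2 V B W C \<phi>"
    using roots V.root_closed
    by (intro symplectic_homI_gen_set[OF V.symplectic_space_axioms W.symplectic_space_axioms
          \<phi>(1) V.roots_generate]) (auto simp: \<phi>(2))
  moreover have "\<phi> ` carrier V = carrier W"
  proof
    have "g ` verts G \<subseteq> \<phi>.im"
      using V.root_closed by (force simp: \<phi>.im_def simp flip: \<phi>(2))
    then have "W.span (g ` verts G) \<subseteq> \<phi>.im"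
      by (rule W.span_is_subset[OF _ \<phi>.im_is_submodule])
    then show "carrier W \<subseteq> \<phi> ` carrier V"
      unfolding W.roots_generate \<phi>.im_def .
  qed auto
  ultimately show ?thesis
    using V.symplectic_root_system_axioms assms(2) \<phi>(2) by (auto simp: srs_quotient_of_def)
qed

section \<open>The coordinate space and its standard basis\<close>

text \<open>Module records inherit the fields \<open>mult\<close> and \<open>one\<close> from rings; their values here are junk.\<close>

definition coord_space :: "'a set \<Rightarrow> ('k::field, 'a \<Rightarrow> 'k) module" where
  "coord_space S = \<lparr>carrier = {v. \<forall>x. x \<notin> S \<longrightarrow> v x = 0},
     mult = (\<lambda>_ _ _. 0), one = (\<lambda>_. 0), zero = (\<lambda>_. 0),
     add = (\<lambda>u v x. u x + v x), smult = (\<lambda>c v x. c * v x)\<rparr>"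

text \<open>The standard basis vectors, defined independently of \<open>S\<close>: they are distinct
  over the whole node type, and those at elements of \<open>S\<close> lie in
  \<open>coord_space S\<close>.\<close>

definition unit_coord :: "'a \<Rightarrow> 'a \<Rightarrow> 'k::field" where
  "unit_coord a x = of_bool (x = a)"

lemma vectorspace_coord_space: "vectorspace class_ring (coord_space S :: ('k::field, 'a \<Rightarrow> 'k) module)"
proof (rule vs_criteria)
  show "\<forall>v\<in>carrier (coord_space S). \<exists>w\<in>carrier (coord_space S).
    v \<oplus>\<^bsub>coord_space S\<^esub> w = \<zero>\<^bsub>coord_space S :: ('k, 'a \<Rightarrow> 'k) module\<^esub>"
    by (rule ballI, rule_tac x = "\<lambda>x. - v x" in bexI) (auto simp: coord_space_def)
qed (auto simp: coord_space_def class_field algebra_simps)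

lemma unit_coord_in_carrier: "a \<in> S \<Longrightarrow> unit_coord a \<in> carrier (coord_space S)"
  by (auto simp: coord_space_def unit_coord_def)

lemma inj_unit_coord: "inj (unit_coord :: 'a \<Rightarrow> 'a \<Rightarrow> 'k::field)"
  by (rule injI) (metis of_bool_eq_iff unit_coord_def)

text \<open>Coefficients are indexed by vectors, so the entry at \<open>x\<close> is the coefficient
  of the unit vector at \<open>x\<close>. Independence and spanning are both read off from this
  formula.\<close>

lemma lincomb_unit_coord:
  fixes c :: "('a \<Rightarrow> 'k::field) \<Rightarrow> 'k"
  assumes "finite S"
  shows "module.lincomb (coord_space S) c (unit_coord ` S) =
    (\<lambda>x. if x \<in> S then c (unit_coord x) else 0)"
proof -
  interpret vectorspace class_ring "coord_space S :: ('k, 'a \<Rightarrow> 'k) module"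
    by (rule vectorspace_coord_space)
  \<comment> \<open>Only the index set \<open>T\<close> varies in the induction; \<open>S\<close>
    stays fixed because it determines the ambient space.\<close>
  have "(\<Oplus>\<^bsub>coord_space S\<^esub>v\<in>unit_coord ` T. c v \<odot>\<^bsub>coord_space S\<^esub> v) =
      (\<lambda>x. if x \<in> T then c (unit_coord x) else 0)" if "finite T" "T \<subseteq> S" for T
    using that
  proof (induction T)
    case empty
    have "\<zero>\<^bsub>coord_space S\<^esub> = (\<lambda>_. 0 :: 'k)" by (simp add: coord_space_def)
    then show ?case by simp
  next
    case (insert a T)
    have "c (unit_coord t) \<odot>\<^bsub>coord_space S\<^esub> unit_coord t \<in> carrier (coord_space S)"
      if "t \<in> insert a T" for t
      using that insert.prems by (auto simp: coord_space_def unit_coord_def)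
    moreover have "unit_coord a \<notin> (unit_coord ` T :: ('a \<Rightarrow> 'k) set)"
      using insert.hyps by (simp add: inj_image_mem_iff[OF inj_unit_coord])
    ultimately have eq: "(\<Oplus>\<^bsub>coord_space S\<^esub>v\<in>unit_coord ` insert a T. c v \<odot>\<^bsub>coord_space S\<^esub> v) =
        (c (unit_coord a) \<odot>\<^bsub>coord_space S\<^esub> unit_coord a) \<oplus>\<^bsub>coord_space S\<^esub>
        (\<lambda>x. if x \<in> T then c (unit_coord x) else 0)"
      using insert by (subst image_insert, subst M.finsum_insert) auto
    show ?case
      unfolding eq using insert.hyps by (auto simp: coord_space_def unit_coord_def fun_eq_iff)
  qed
  from this[OF assms subset_refl] show ?thesis by (simp add: lincomb_def)
qed

lemma basis_unit_coord:
  assumes "finite S"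
  shows "vectorspace.basis class_ring (coord_space S :: ('k::field, 'a \<Rightarrow> 'k) module) (unit_coord ` S)"
proof -
  interpret vectorspace class_ring "coord_space S :: ('k, 'a \<Rightarrow> 'k) module"
    by (rule vectorspace_coord_space)
  have sub: "unit_coord ` S \<subseteq> carrier (coord_space S :: ('k, 'a \<Rightarrow> 'k) module)"
    by (auto simp: unit_coord_in_carrier)
  have "lin_indpt (unit_coord ` S)"
  proof (rule finite_lin_indpt2)
    fix a :: "('a \<Rightarrow> 'k) \<Rightarrow> 'k"
    assume "lincomb a (unit_coord ` S) = \<zero>\<^bsub>coord_space S\<^esub>"
    then have zero: "(\<lambda>x. if x \<in> S then a (unit_coord x) else 0) = (\<lambda>_. 0)"
      by (simp add: lincomb_unit_coord[OF assms]) (simp add: coord_space_def)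
    have "a (unit_coord x) = 0" if "x \<in> S" for x
      using fun_cong[OF zero, of x] that by simp
    then show "\<forall>v\<in>unit_coord ` S. a v = \<zero>\<^bsub>class_ring\<^esub>" by simp
  qed (use assms sub in auto)
  moreover have "gen_set (unit_coord ` S)"
  proof
    show "carrier (coord_space S) \<subseteq> span (unit_coord ` S)"
    proof
      fix v :: "'a \<Rightarrow> 'k" assume v: "v \<in> carrier (coord_space S)"
      \<comment> \<open>The coefficient of a unit vector is the entry of \<open>v\<close> at its
        node, recovered by inverting \<open>unit_coord\<close>. Outside \<open>S\<close> both sides
        are 0 since \<open>v\<close> lies in the carrier.\<close>
      have "v = lincomb (\<lambda>w. v (inv_into UNIV unit_coord w)) (unit_coord ` S)"
        using v unfolding lincomb_unit_coord[OF assms]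
        by (auto simp: inj_unit_coord coord_space_def)
      then show "v \<in> span (unit_coord ` S)"
        using assms by (auto simp: span_def)
    qed
  qed (rule span_is_subset2[OF sub])
  ultimately show ?thesis using sub by (simp add: basis_def)
qed

section \<open>The adjacency form and existence\<close>

text \<open>The terms at (a, b) and (b, a) cancel in characteristic 2. In the induction, the row and
  the column of the new index are equal sums, and their corner is a zero diagonal entry.\<close>

lemma sum_symmetric_zero_diagonal_bit:
  fixes h :: "'a \<Rightarrow> 'a \<Rightarrow> bit"
  assumes "finite S" and sym: "\<And>a b. h a b = h b a" and diag: "\<And>a. h a a = 0"
  shows "(\<Sum>a\<in>S. \<Sum>b\<in>S. h a b) = 0"
  using assms(1)
proof induction
  case (insert x S)
  have "(\<Sum>a\<in>insert x S. \<Sum>b\<in>insert x S. h a b) =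
      (\<Sum>b\<in>S. h x b) + ((\<Sum>a\<in>S. h a x) + (\<Sum>a\<in>S. \<Sum>b\<in>S. h a b))"
    using insert.hyps diag by (simp add: sum.distrib del: add_bit_eq_xor)
  also have "(\<Sum>a\<in>S. h a x) = (\<Sum>b\<in>S. h x b)" by (simp add: sym)
  finally show ?case using insert.IH by simp
qed simp

definition adj_form :: "('a, 'b) pre_digraph \<Rightarrow> ('a \<Rightarrow> bit) \<Rightarrow> ('a \<Rightarrow> bit) \<Rightarrow> bit" where
  "adj_form G u v = (\<Sum>a\<in>verts G. \<Sum>b\<in>verts G. of_bool (a \<rightarrow>\<^bsub>G\<^esub> b) * (u a * v b))"

lemma adj_form_unit_coord:
  assumes "finite (verts G)" and "a \<in> verts G" and "b \<in> verts G"
  shows "adj_form G (unit_coord a) (unit_coord b) = of_bool (a \<rightarrow>\<^bsub>G\<^esub> b)"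
proof -
  \<comment> \<open>In this shape the inner sum collapses at \<open>b\<close> and the outer one at
    \<open>a\<close>, both being nodes.\<close>
  have "adj_form G (unit_coord a) (unit_coord b) =
      (\<Sum>x\<in>verts G. \<Sum>y\<in>verts G. if y = b then if x = a then of_bool (a \<rightarrow>\<^bsub>G\<^esub> b) else 0 else 0)"
    unfolding adj_form_def by (intro sum.cong refl) (auto simp: unit_coord_def)
  then show ?thesis using assms by simp
qed

lemma symplectic_space_adj_form:
  assumes "graph G"
  shows "symplectic_space F2 (coord_space (verts G)) (adj_form G)"
proof -
  interpret graph G by (rule assms)
  interpret vectorspace F2 "coord_space (verts G) :: (bit, 'a \<Rightarrow> bit) module"
    by (rule vectorspace_coord_space)
  have "basis (unit_coord ` verts G)" by (rule basis_unit_coord) simp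
  then have fin_dim
    unfolding fin_dim_def basis_def by (intro exI[of _ "unit_coord ` verts G"])
      (elim conjE, intro conjI, simp)
  \<comment> \<open>Bilinearity is stated for pointwise operations on arbitrary functions, the form
    that the operations of \<open>coord_space\<close> unfold to.\<close>
  moreover have "adj_form G (\<lambda>x. u x + v x) w = adj_form G u w + adj_form G v w" for u v w
    unfolding adj_form_def by (simp only: distrib_left distrib_right sum.distrib)
  moreover have "adj_form G u (\<lambda>x. v x + w x) = adj_form G u v + adj_form G u w" for u v w
    unfolding adj_form_def by (simp only: distrib_left sum.distrib)
  moreover have "adj_form G (\<lambda>x. c * u x) v = c * adj_form G u v" for c u v
    unfolding adj_form_def by (simp only: sum_distrib_left mult_ac)
  moreover have "adj_form G u (\<lambda>x. c * v x) = c * adj_form G u v" for c u v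
    unfolding adj_form_def by (simp only: sum_distrib_left mult_ac)
  \<comment> \<open>The summands are symmetric because arcs come in opposite pairs, and zero on the
    diagonal because there are no loops.\<close>
  moreover have "adj_form G v v = 0" for v
    unfolding adj_form_def
  proof (rule sum_symmetric_zero_diagonal_bit)
    have "(a \<rightarrow>\<^bsub>G\<^esub> b) = (b \<rightarrow>\<^bsub>G\<^esub> a)" for a b
      using arcs_ends_symmetric[OF sym_arcs] by blast
    then show "of_bool (a \<rightarrow>\<^bsub>G\<^esub> b) * (v a * v b) = of_bool (b \<rightarrow>\<^bsub>G\<^esub> a) * (v b * v a)" for a b
      by (simp only: mult_ac)
    show "of_bool (a \<rightarrow>\<^bsub>G\<^esub> a) * (v a * v a) = 0" for a
      using adj_not_same by auto
  qed simp
  ultimately show ?thesis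
    by unfold_locales (simp_all add: coord_space_def del: add_bit_eq_xor mult_bit_eq_and)
qed

lemma minimal_srs_coord_space:
  assumes "graph G"
  shows "minimal_symplectic_root_system G (coord_space (verts G)) (adj_form G) unit_coord"
proof -
  interpret graph G by (rule assms)
  interpret symplectic_space F2 "coord_space (verts G)" "adj_form G"
    by (rule symplectic_space_adj_form) (rule assms)
  have basis: "basis (unit_coord ` verts G)" by (rule basis_unit_coord) simp
  show ?thesis
  proof unfold_locales
    show "gen_set (unit_coord ` verts G)" using basis unfolding basis_def by blast
    show "inj_on unit_coord (verts G)" using inj_unit_coord by (rule inj_on_subset) simp
    show "basis (unit_coord ` verts G)" by (rule basis)
    show "unit_coord \<alpha> \<in> carrier (coord_space (verts G))" if "\<alpha> \<in> verts G" for \<alpha>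
      using that by (rule unit_coord_in_carrier)
    show "\<alpha> \<rightarrow>\<^bsub>G\<^esub> \<beta> \<longleftrightarrow> adj_form G (unit_coord \<alpha>) (unit_coord \<beta>) \<noteq> 0"
      if "\<alpha> \<in> verts G" "\<beta> \<in> verts G" for \<alpha> \<beta>
      unfolding adj_form_unit_coord[OF finite_verts that] by simp
  qed
qed

text \<open>Existence names a concrete type for the space. The other two claims hold for arbitrary,
  possibly different vector types \<open>'v\<close> and \<open>'w\<close>, so they can be
  instantiated to compare the constructed system with any other.\<close>

theorem corollary3p12:
  fixes G :: "('a, 'b) pre_digraph"
  assumes "graph G"
  shows "(\<exists>(V :: (bit, 'a \<Rightarrow> bit) module) B f. minimal_symplectic_root_system G V B f) \<and>
    (\<forall>(V :: (bit, 'v) module) B f (W :: (bit, 'w) module) C g.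
      minimal_symplectic_root_system G V B f \<and> minimal_symplectic_root_system G W C g
        \<longrightarrow> srs_isomorphic G V f W g) \<and>
    (\<forall>(V :: (bit, 'v) module) B f (W :: (bit, 'w) module) C g.
      minimal_symplectic_root_system G V B f \<and> symplectic_root_system G W C g
        \<longrightarrow> srs_quotient_of G W C g V B f)"
proof (intro conjI allI impI)
  show "\<exists>(V :: (bit, 'a \<Rightarrow> bit) module) B f. minimal_symplectic_root_system G V B f"
    by (intro exI) (rule minimal_srs_coord_space[OF assms])
next
  fix V :: "(bit, 'v) module" and W :: "(bit, 'w) module" and B C f g
  assume "minimal_symplectic_root_system G V B f \<and> minimal_symplectic_root_system G W C g"
  then show "srs_isomorphic G V f W g"
    by (elim conjE) (rule minimal_imp_isomorphic)
next
  fix V :: "(bit, 'v) module" and W :: "(bit, 'w) module" and B C f g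
  assume "minimal_symplectic_root_system G V B f \<and> symplectic_root_system G W C g"
  then show "srs_quotient_of G W C g V B f"
    by (elim conjE) (rule quotient_of_minimal)
qed

end
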